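(* Let $p$ be a prime, let $m$ be an odd positive integer with $p\nmid m$, let $K$ be a field of characteristic $p$ containing all $m$-th roots of unity, and let $c\in K$. Let $a$ be an integer with $p<a<m/2$ and let $\tau=\rho_a$ be the two-dimensional representation of the dihedral group $D_m=G(m,m,2)$. Then $x_1^p\otimes e_1,\ x_1^p\otimes e_2,\ x_2^p\otimes e_1,\ x_2^p\otimes e_2\in J_c$.
   Context: Let $\zeta\in K$ be a primitive $m$-th root of unity. The reflections of $D_m$ are $s_k$, $0\le k<m$, acting on $\mathfrak h^*=Kx_1\oplus Kx_2$ by the matrix $\begin{bmatrix}0&\zeta^{-k}\\ \zeta^{k}&0\end{bmatrix}$, i.e. $s_k(x_1)=\zeta^kx_2$, $s_k(x_2)=\zeta^{-k}x_1$; they generate $D_m$, and $\alpha_{s_k}=x_1-\zeta^kx_2$ spans the image of $1-s_k$. Since $m$ is odd all reflections are conjugate, so there is a single parameter $c$. For $1\le a<m/2$, the irreducible representation $\rho_a$ of $D_m$ has basis $e_1,e_2$ with $s_k$ acting by $\begin{bmatrix}0&\zeta^{-ak}\\ \zeta^{ak}&0\end{bmatrix}$, i.e. $s_k(e_1)=\zeta^{ak}e_2$, $s_k(e_2)=\zeta^{-ak}e_1$. Let $y_1,y_2$ be the basis of $\mathfrak h$ dual to $x_1,x_2$. The Verma module of the rational Cherednik algebra $H_{1,c}(D_m,\mathfrak h)$ is $M_c(\tau)=K[x_1,x_2]\otimes\tau$, graded by polynomial degree, where $x_i$ acts by multiplication, $D_m$ acts diagonally, and $y_i$ acts by the Dunkl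 operator $D_i(f\otimes v)=\frac{\partial f}{\partial x_i}\otimes v-\sum_{k=0}^{m-1}c\,(y_i,\alpha_{s_k})\frac{f-s_k(f)}{\alpha_{s_k}}\otimes s_k(v)$, where $(y_1,\alpha_{s_k})=1$ and $(y_2,\alpha_{s_k})=-\zeta^k$. $J_c$ is the unique maximal proper graded submodule of $M_c(\tau)$ (submodule: stable under multiplication by $x_1,x_2$, under $D_m$, and under $D_1,D_2$). *)

theory Defs
  imports "HOL-Computational_Algebra.Computational_Algebra" "HOL-Library.Product_Plus"
begin

definition primitive_root_of_unity :: "nat \<Rightarrow> 'k::field \<Rightarrow> bool" where
  "primitive_root_of_unity m \<zeta> \<longleftrightarrow> \<zeta> ^ m = 1 \<and> (\<forall>j. 0 < j \<and> j < m \<longrightarrow> \<zeta> ^ j \<noteq> 1)"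


text \<open>
  The polynomial ring \<open>K[x\<^sub>1, x\<^sub>2]\<close> is the type \<open>'k poly poly\<close>; the inner variable is
  \<open>x\<^sub>1\<close> and the outer variable is \<open>x\<^sub>2\<close>, so that the coefficient of \<open>x\<^sub>1\<^sup>i x\<^sub>2\<^sup>j\<close> in \<open>f\<close> is
  \<open>coeff (coeff f j) i\<close>. Indices \<open>i :: nat\<close> of the variables \<open>x\<^sub>i\<close>, of the dual vectors \<open>y\<^sub>i\<close>
  and of the Dunkl operators \<open>D\<^sub>i\<close> are only used for \<open>i = 1\<close> and \<open>i = 2\<close>.
\<close>

type_synonym 'k poly2 = "'k poly poly"

definition Const :: "'k::field \<Rightarrow> 'k poly2" where
  "Const b = [:[:b:]:]"

definition var :: "nat \<Rightarrow> 'k::field poly2" where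
  "var i = (if i = 1 then [:[:0, 1:]:] else [:0, 1:])"

definition partial_deriv :: "nat \<Rightarrow> 'k::field poly2 \<Rightarrow> 'k poly2" where
  "partial_deriv i f = (if i = 1 then map_poly pderiv f else pderiv f)"

text \<open>The result \<open>f(g\<^sub>1, g\<^sub>2)\<close> of substituting \<open>g\<^sub>1\<close> for \<open>x\<^sub>1\<close> and \<open>g\<^sub>2\<close> for \<open>x\<^sub>2\<close>.\<close>

definition subst2 :: "'k::field poly2 \<Rightarrow> 'k poly2 \<Rightarrow> 'k poly2 \<Rightarrow> 'k poly2" where
  "subst2 f g1 g2 = poly (map_poly (\<lambda>q. poly (map_poly Const q) g1) f) g2"

definition hom_component :: "nat \<Rightarrow> 'k::field poly2 \<Rightarrow> 'k poly2" where
  "hom_component d f = (\<Sum>j\<le>d. monom (monom (coeff (coeff f j) (d - j)) (d - j)) j)"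


text \<open>
  Both \<open>\<hh>\<^sup>* = K x\<^sub>1 \<oplus> K x\<^sub>2\<close> and \<open>\<rho>\<^sub>a = K e\<^sub>1 \<oplus> K e\<^sub>2\<close> are represented by coordinate
  pairs in \<open>'k \<times> 'k\<close>. A linear form is turned into a polynomial by \<open>linear_poly\<close>.
\<close>

definition linear_poly :: "'k::field \<times> 'k \<Rightarrow> 'k poly2" where
  "linear_poly u = Const (fst u) * var 1 + Const (snd u) * var 2"

definition pairing :: "nat \<Rightarrow> 'k::field \<times> 'k \<Rightarrow> 'k" where
  "pairing i u = (if i = 1 then fst u else snd u)"

text \<open>
  The linear map with matrix \<open>[0, \<zeta>\<^bsup>-n\<^esup>; \<zeta>\<^bsup>n\<^esup>, 0]\<close>. The reflection \<open>s\<^sub>k\<close> acts on \<open>\<hh>\<^sup>*\<close>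
  by \<open>antidiag \<zeta> k\<close> and on \<open>\<rho>\<^sub>a\<close> by \<open>antidiag \<zeta> (a * k)\<close>.
\<close>

definition antidiag :: "'k::field \<Rightarrow> nat \<Rightarrow> 'k \<times> 'k \<Rightarrow> 'k \<times> 'k" where
  "antidiag \<zeta> n u = (inverse (\<zeta> ^ n) * snd u, \<zeta> ^ n * fst u)"

definition refl_s :: "'k::field \<Rightarrow> nat \<Rightarrow> 'k \<times> 'k \<Rightarrow> 'k \<times> 'k" where
  "refl_s \<zeta> k = antidiag \<zeta> k"

definition rho_s :: "'k::field \<Rightarrow> nat \<Rightarrow> nat \<Rightarrow> 'k \<times> 'k \<Rightarrow> 'k \<times> 'k" where
  "rho_s \<zeta> a k = antidiag \<zeta> (a * k)"

definition alpha_root :: "'k::field \<Rightarrow> nat \<Rightarrow> 'k \<times> 'k" where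
  "alpha_root \<zeta> k = (1, - (\<zeta> ^ k))"

text \<open>
  The graph of the representation \<open>\<rho>\<^sub>a\<close> of \<open>D\<^sub>m\<close>: the group \<open>D\<^sub>m \<subseteq> GL(\<hh>\<^sup>*)\<close> generated by the
  reflections, each element \<open>g\<close> being paired with the linear map \<open>\<rho>\<^sub>a(g)\<close>. The reflections are
  involutions, so closure under composition suffices.
\<close>

inductive_set dihedral_rep ::
  "nat \<Rightarrow> 'k::field \<Rightarrow> nat \<Rightarrow> (('k \<times> 'k \<Rightarrow> 'k \<times> 'k) \<times> ('k \<times> 'k \<Rightarrow> 'k \<times> 'k)) set"
  for m :: nat and \<zeta> :: 'k and a :: nat where
  one: "(id, id) \<in> dihedral_rep m \<zeta> a"
| refl: "k < m \<Longrightarrow> (refl_s \<zeta> k, rho_s \<zeta> a k) \<in> dihedral_rep m \<zeta> a"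
| comp: "(g, r) \<in> dihedral_rep m \<zeta> a \<Longrightarrow> (g', r') \<in> dihedral_rep m \<zeta> a \<Longrightarrow>
    (g \<circ> g', r \<circ> r') \<in> dihedral_rep m \<zeta> a"

text \<open>The action of a linear map \<open>g\<close> of \<open>\<hh>\<^sup>*\<close> on \<open>K[x\<^sub>1, x\<^sub>2] = S \<hh>\<^sup>*\<close> by algebra homomorphisms.\<close>

definition act_poly :: "('k::field \<times> 'k \<Rightarrow> 'k \<times> 'k) \<Rightarrow> 'k poly2 \<Rightarrow> 'k poly2" where
  "act_poly g f = subst2 f (linear_poly (g (1, 0))) (linear_poly (g (0, 1)))"


text \<open>
  The Verma module \<open>K[x\<^sub>1, x\<^sub>2] \<otimes> \<rho>\<^sub>a\<close>; the pair \<open>(f\<^sub>1, f\<^sub>2)\<close> stands for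
  \<open>f\<^sub>1 \<otimes> e\<^sub>1 + f\<^sub>2 \<otimes> e\<^sub>2\<close>.
\<close>

type_synonym 'k verma = "'k poly2 \<times> 'k poly2"

definition tensor :: "'k::field poly2 \<Rightarrow> 'k \<times> 'k \<Rightarrow> 'k verma" where
  "tensor f v = (Const (fst v) * f, Const (snd v) * f)"

definition basis_e :: "nat \<Rightarrow> 'k::field \<times> 'k" where
  "basis_e i = (if i = 1 then (1, 0) else (0, 1))"

definition tensor_extend :: "('k::field poly2 \<Rightarrow> 'k \<times> 'k \<Rightarrow> 'k verma) \<Rightarrow> 'k verma \<Rightarrow> 'k verma" where
  "tensor_extend T F = T (fst F) (basis_e 1) + T (snd F) (basis_e 2)"

definition scale :: "'k::field poly2 \<Rightarrow> 'k verma \<Rightarrow> 'k verma" where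
  "scale g F = (g * fst F, g * snd F)"

definition diag_action ::
  "('k::field \<times> 'k \<Rightarrow> 'k \<times> 'k) \<Rightarrow> ('k \<times> 'k \<Rightarrow> 'k \<times> 'k) \<Rightarrow> 'k verma \<Rightarrow> 'k verma" where
  "diag_action g r = tensor_extend (\<lambda>f v. tensor (act_poly g f) (r v))"

text \<open>
  The \<open>div\<close> below is the exact quotient of polynomials; see \<open>alpha_root_dvd\<close> for the
  divisibility.
\<close>

definition dunkl :: "nat \<Rightarrow> 'k::field \<Rightarrow> 'k \<Rightarrow> nat \<Rightarrow> nat \<Rightarrow> 'k verma \<Rightarrow> 'k verma" where
  "dunkl m \<zeta> c a i = tensor_extend (\<lambda>f v.
     tensor (partial_deriv i f) v -
     (\<Sum>k<m. tensor (Const (c * pairing i (alpha_root \<zeta> k)) *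
                      ((f - act_poly (refl_s \<zeta> k) f) div linear_poly (alpha_root \<zeta> k)))
                    (rho_s \<zeta> a k v)))"

definition is_subspace :: "'k::field verma set \<Rightarrow> bool" where
  "is_subspace N \<longleftrightarrow> 0 \<in> N \<and> (\<forall>F\<in>N. \<forall>G\<in>N. F + G \<in> N) \<and> (\<forall>b. \<forall>F\<in>N. scale (Const b) F \<in> N)"

definition is_submodule :: "nat \<Rightarrow> 'k::field \<Rightarrow> 'k \<Rightarrow> nat \<Rightarrow> 'k verma set \<Rightarrow> bool" where
  "is_submodule m \<zeta> c a N \<longleftrightarrow> is_subspace N \<and>
     (\<forall>i\<in>{1, 2}. \<forall>F\<in>N. scale (var i) F \<in> N) \<and>
     (\<forall>(g, r)\<in>dihedral_rep m \<zeta> a. \<forall>F\<in>N. diag_action g r F \<in> N) \<and>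
     (\<forall>i\<in>{1, 2}. \<forall>F\<in>N. dunkl m \<zeta> c a i F \<in> N)"

definition is_graded :: "'k::field verma set \<Rightarrow> bool" where
  "is_graded N \<longleftrightarrow> (\<forall>F\<in>N. \<forall>d. (hom_component d (fst F), hom_component d (snd F)) \<in> N)"

definition proper_graded_submodule :: "nat \<Rightarrow> 'k::field \<Rightarrow> 'k \<Rightarrow> nat \<Rightarrow> 'k verma set \<Rightarrow> bool" where
  "proper_graded_submodule m \<zeta> c a N \<longleftrightarrow> is_submodule m \<zeta> c a N \<and> is_graded N \<and> N \<noteq> UNIV"

definition Jc :: "nat \<Rightarrow> 'k::field \<Rightarrow> 'k \<Rightarrow> nat \<Rightarrow> 'k verma set" where
  "Jc m \<zeta> c a = (THE N. proper_graded_submodule m \<zeta> c a N \<and>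
     (\<forall>N'. proper_graded_submodule m \<zeta> c a N' \<and> N \<subseteq> N' \<longrightarrow> N' = N))"


lemma Const_0 [simp]: "Const 0 = 0" and Const_1 [simp]: "Const 1 = 1"
  and Const_mult: "Const (b * b') = Const b * Const b'"
  by (simp_all add: Const_def one_pCons)

lemma subst2_pCons:
  "subst2 (pCons q f) g1 g2 = poly (map_poly Const q) g1 + g2 * subst2 f g1 g2"
  by (cases "q = 0 \<and> f = 0") (auto simp: subst2_def map_poly_pCons)

lemma act_poly_refl_s:
  "act_poly (refl_s \<zeta> k) f = subst2 f (Const (\<zeta> ^ k) * var 2) (Const (inverse (\<zeta> ^ k)) * var 1)"
  by (simp add: act_poly_def refl_s_def antidiag_def linear_poly_def)

lemma alpha_root_dvd:
  assumes "\<zeta> \<noteq> 0"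
  shows "linear_poly (alpha_root \<zeta> k) dvd f - act_poly (refl_s \<zeta> k) f"
proof -
  define g1 :: "'a poly2" where "g1 = Const (\<zeta> ^ k) * var 2"
  define g2 :: "'a poly2" where "g2 = Const (inverse (\<zeta> ^ k)) * var 1"
  define \<alpha> where "\<alpha> = linear_poly (alpha_root \<zeta> k)"
  have a1: "\<alpha> = var 1 - g1"
    by (simp add: \<alpha>_def linear_poly_def alpha_root_def g1_def Const_def var_def)
  have "Const (inverse (\<zeta> ^ k)) * g1 = var 2"
    using assms by (simp add: g1_def mult.assoc [symmetric] Const_mult [symmetric])
  hence "var 2 - g2 = - Const (inverse (\<zeta> ^ k)) * \<alpha>"
    by (simp add: a1 g2_def right_diff_distrib)
  hence a2: "\<alpha> dvd var 2 - g2" by simp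
  have q: "\<alpha> dvd [:q:] - poly (map_poly Const q) g1" for q
  proof (induction q)
    case (pCons b q)
    have "[:pCons b q:] - poly (map_poly Const (pCons b q)) g1
        = var 1 * [:q:] - g1 * poly (map_poly Const q) g1"
      using pCons.hyps by (auto simp: map_poly_pCons var_def Const_def)
    also have "\<dots> = \<alpha> * [:q:] + g1 * ([:q:] - poly (map_poly Const q) g1)"
      unfolding a1 by (simp add: algebra_simps)
    finally show ?case
      by (simp only:) (intro dvd_add dvd_triv_left dvd_mult pCons.IH)
  qed simp
  have "\<alpha> dvd f - subst2 f g1 g2"
  proof (induction f)
    case 0
    show ?case by (simp add: subst2_def)
  next
    case (pCons b f)
    have eq: "pCons b f = [:b:] + var 2 * f" by (simp add: var_def)
    have "pCons b f - subst2 (pCons b f) g1 g2 =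
      ([:b:] - poly (map_poly Const b) g1) + ((var 2 - g2) * f + g2 * (f - subst2 f g1 g2))"
      unfolding subst2_pCons by (subst eq) (simp add: algebra_simps)
    moreover have "\<alpha> dvd ([:b:] - poly (map_poly Const b) g1) + ((var 2 - g2) * f + g2 * (f - subst2 f g1 g2))"
      by (intro dvd_add q dvd_mult dvd_mult2 a2 pCons.IH)
    ultimately show ?case by (simp only:)
  qed
  thus ?thesis by (simp add: act_poly_refl_s \<alpha>_def g1_def g2_def)
qed

end

theory Submission
  imports Defs
begin

text \<open>
  Let \<open>I\<close> be the ideal generated by \<open>x\<^sub>1\<^sup>p\<close> and \<open>x\<^sub>2\<^sup>p\<close>. The Dunkl operators kill every \<open>x\<^sub>j\<^sup>p \<otimes> e\<^sub>i\<close>: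
  the derivative vanishes in characteristic \<open>p\<close>, and each coefficient of the remaining sum over the
  reflections is, up to a scalar, a sum of \<open>\<zeta>\<^bsup>kn\<^esup>\<close> over \<open>k < m\<close> in which \<open>n\<close> differs from \<open>a\<close> or \<open>-a\<close> by at
  most \<open>p\<close>, so that \<open>p < a < m/2\<close> prevents \<open>m\<close> from dividing \<open>n\<close>. By the twisted Leibniz rule for
  \<open>(f - s\<^sub>k f) / \<alpha>\<^sub>k\<close> it follows that \<open>I \<otimes> \<rho>\<^sub>a\<close> is stable under the Dunkl operators; it is stable under
  the group by the Frobenius identity. As \<open>\<rho>\<^sub>a\<close> is irreducible, a graded submodule is proper iff it
  vanishes in degree \<open>0\<close>. Hence the sum of two proper graded submodules is proper, and \<open>J\<^sub>c\<close> is the union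
  of all of them.
\<close>

text \<open>Otherwise \<open>var 1\<close> is rewritten to \<open>var (Suc 0)\<close>.\<close>
declare One_nat_def [simp del]

section \<open>Linear substitutions as ring homomorphisms\<close>

lemma Const_add: "Const (b + b') = Const b + Const b'"
  and Const_diff: "Const (b - b') = Const b - Const b'"
  and Const_minus: "Const (- b) = - Const b"
  by (simp_all add: Const_def)

lemma Const_power: "Const (b ^ n) = Const b ^ n"
  by (induction n) (simp_all add: Const_mult)

lemma Const_sum: "Const (sum f A) = (\<Sum>x\<in>A. Const (f x))"
  by (induction A rule: infinite_finite_induct) (simp_all add: Const_add)

text \<open>\<open>subst2\<close> is an evaluation nested in an evaluation. With an arbitrary
  coefficient map \<open>h\<close>, this and \<open>poly_map_poly_mult\<close> serve twice: for
  \<open>Const\<close> in the inner variable, and for the inner evaluation itself in the outer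
  one.\<close>

lemma poly_map_poly_add:
  assumes "h 0 = 0" "\<And>x y. h (x + y) = h x + h y"
  shows "poly (map_poly h (p + q)) z = poly (map_poly h p) z + poly (map_poly h q) z"
proof -
  have "map_poly h (p + q) = map_poly h p + map_poly h q"
    by (intro poly_eqI) (simp add: coeff_map_poly assms)
  thus ?thesis by simp
qed

lemma poly_map_poly_mult:
  assumes "h 0 = 0" "\<And>x y. h (x + y) = h x + h y" "\<And>x y. h (x * y) = h x * h y"
  shows "poly (map_poly h (p * q)) z = poly (map_poly h p) z * poly (map_poly h q) z"
proof (induction p)
  case (pCons b p)
  show ?case
    by (simp add: mult_pCons_left poly_map_poly_add map_poly_smult map_poly_pCons assms pCons.IH
        algebra_simps)
qed simp

lemma act_poly_add: "act_poly g (f + h) = act_poly g f + act_poly g h"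
  unfolding act_poly_def subst2_def
  by (intro poly_map_poly_add) (simp_all add: poly_map_poly_add Const_add)

lemma act_poly_mult: "act_poly g (f * h) = act_poly g f * act_poly g h"
  unfolding act_poly_def subst2_def
  by (intro poly_map_poly_mult) (simp_all add: poly_map_poly_add poly_map_poly_mult Const_add Const_mult)

lemma act_poly_Const [simp]: "act_poly g (Const b) = Const b"
  by (simp add: act_poly_def subst2_def Const_def map_poly_pCons)

lemma act_poly_1 [simp]: "act_poly g 1 = 1"
  using act_poly_Const [of g 1] by simp

lemma act_poly_power: "act_poly g (f ^ n) = act_poly g f ^ n"
  by (induction n) (simp_all add: act_poly_mult)

lemma act_poly_var:
  "act_poly g (var 1) = linear_poly (g (1, 0))" "act_poly g (var 2) = linear_poly (g (0, 1))"
  by (simp_all add: act_poly_def subst2_def var_def map_poly_pCons flip: one_pCons)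

lemma act_poly_refl_var:
  "act_poly (refl_s \<zeta> k) (var 1) = Const (\<zeta> ^ k) * var 2"
  "act_poly (refl_s \<zeta> k) (var 2) = Const (inverse (\<zeta> ^ k)) * var 1"
  by (simp_all only: act_poly_var) (simp_all add: refl_s_def antidiag_def linear_poly_def)

lemma var_power:
  "(var 1 :: 'k::field poly2) ^ n = [:monom 1 n:]" "(var 2 :: 'k poly2) ^ n = monom 1 n"
proof -
  show "(var 1 :: 'k poly2) ^ n = [:monom 1 n:]"
    by (induction n) (auto simp: var_def monom_Suc monom_0 one_pCons)
  show "(var 2 :: 'k poly2) ^ n = monom 1 n"
    by (simp add: var_def monom_altdef)
qed

lemma monom_eq_var: "monom (monom b i) j = Const b * (var 1 ^ i * var 2 ^ j)"
  by (simp add: var_power Const_def smult_monom)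

section \<open>Divided differences attached to the reflections\<close>

definition root_poly :: "'k::field \<Rightarrow> nat \<Rightarrow> 'k poly2" where
  "root_poly \<zeta> k = linear_poly (alpha_root \<zeta> k)"

text \<open>The divided difference of Demazure type for the reflection with index \<open>k\<close>,
  as it occurs in the Dunkl operators.\<close>

definition div_diff :: "'k::field \<Rightarrow> nat \<Rightarrow> 'k poly2 \<Rightarrow> 'k poly2" where
  "div_diff \<zeta> k f = (f - act_poly (refl_s \<zeta> k) f) div root_poly \<zeta> k"

lemma root_poly_eq: "root_poly \<zeta> k = var 1 - Const (\<zeta> ^ k) * var 2"
  by (simp add: root_poly_def linear_poly_def alpha_root_def Const_minus)

lemma root_poly_nonzero: "root_poly \<zeta> k \<noteq> 0"
  by (simp add: root_poly_eq var_def Const_def)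

lemma div_diff_mult_root:
  assumes "\<zeta> \<noteq> 0"
  shows "root_poly \<zeta> k * div_diff \<zeta> k f = f - act_poly (refl_s \<zeta> k) f"
  using alpha_root_dvd [OF assms, of k f] by (simp add: div_diff_def root_poly_def)

text \<open>In a domain an exact quotient is determined by its product with the root, so identities
  for \<open>div_diff\<close> can be checked after clearing the denominator.\<close>

lemma div_diff_eqI:
  assumes "root_poly \<zeta> k * h = f - act_poly (refl_s \<zeta> k) f"
  shows "div_diff \<zeta> k f = h"
  unfolding div_diff_def assms [symmetric] by (simp add: root_poly_nonzero)

lemma div_diff_add:
  assumes "\<zeta> \<noteq> 0"
  shows "div_diff \<zeta> k (f + g) = div_diff \<zeta> k f + div_diff \<zeta> k g"
  by (rule div_diff_eqI) (simp add: ring_distribs div_diff_mult_root [OF assms] act_poly_add)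

text \<open>Twisted Leibniz rule. With s the action of the reflection, w f - s(w) s(f) = (w - s(w))
  f + s(w) (f - s(f)).\<close>

lemma div_diff_mult:
  assumes "\<zeta> \<noteq> 0"
  shows "div_diff \<zeta> k (w * f) = div_diff \<zeta> k w * f + act_poly (refl_s \<zeta> k) w * div_diff \<zeta> k f"
proof (rule div_diff_eqI)
  let ?s = "act_poly (refl_s \<zeta> k)" and ?\<alpha> = "root_poly \<zeta> k"
  have "?\<alpha> * (div_diff \<zeta> k w * f + ?s w * div_diff \<zeta> k f) =
      (?\<alpha> * div_diff \<zeta> k w) * f + ?s w * (?\<alpha> * div_diff \<zeta> k f)"
    by (simp add: algebra_simps)
  also have "\<dots> = w * f - ?s (w * f)"
    by (simp add: div_diff_mult_root [OF assms] act_poly_mult algebra_simps)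
  finally show "?\<alpha> * (div_diff \<zeta> k w * f + ?s w * div_diff \<zeta> k f) = w * f - ?s (w * f)" .
qed

text \<open>The reflection sends x1 to y = \<open>Const (\<zeta> ^ k) * var 2\<close>, and the root
  is x1 - y, so this is the geometric factorization of x1^n - y^n.\<close>

lemma div_diff_var1_power:
  "div_diff \<zeta> k (var 1 ^ n) = (\<Sum>i<n. Const (\<zeta> ^ (k * i)) * (var 1 ^ (n - Suc i) * var 2 ^ i))"
proof (rule div_diff_eqI)
  let ?y = "Const (\<zeta> ^ k) * var 2"
  \<comment> \<open>Putting \<open>?y\<close> first makes the summation index the exponent of
    \<open>?y\<close>; the sign is reversed afterwards.\<close>
  have "?y ^ n - var 1 ^ n = (?y - var 1) * (\<Sum>i<n. var 1 ^ (n - Suc i) * ?y ^ i)"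
    by (rule power_diff_sumr2)
  from arg_cong [OF this, of uminus]
  have "var 1 ^ n - ?y ^ n = (var 1 - ?y) * (\<Sum>i<n. var 1 ^ (n - Suc i) * ?y ^ i)"
    by (simp only: minus_diff_eq mult_minus_left [symmetric])
  moreover have "var 1 ^ (n - Suc i) * ?y ^ i = Const (\<zeta> ^ (k * i)) * (var 1 ^ (n - Suc i) * var 2 ^ i)" for i
    unfolding power_mult [of \<zeta>] Const_power [of "\<zeta> ^ k"] by (simp only: power_mult_distrib mult_ac)
  ultimately show "root_poly \<zeta> k * (\<Sum>i<n. Const (\<zeta> ^ (k * i)) * (var 1 ^ (n - Suc i) * var 2 ^ i)) =
    var 1 ^ n - act_poly (refl_s \<zeta> k) (var 1 ^ n)"
    by (simp only: act_poly_power act_poly_refl_var root_poly_eq)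
qed

text \<open>With y the image of x1, x2 is \<zeta>^(-k) y and is sent to \<zeta>^(-k) x1. The
  numerator is thus \<zeta>^(-kn) (y^n - x1^n), a multiple of the one for x1^n.\<close>

lemma div_diff_var2_power:
  assumes "\<zeta> \<noteq> 0"
  shows "div_diff \<zeta> k (var 2 ^ n) = - Const (inverse (\<zeta> ^ k) ^ n) * div_diff \<zeta> k (var 1 ^ n)"
proof (rule div_diff_eqI)
  let ?b = "Const (inverse (\<zeta> ^ k) ^ n)" and ?y = "Const (\<zeta> ^ k) * var 2"
  have "?b * Const (\<zeta> ^ k) ^ n = Const ((inverse (\<zeta> ^ k) * \<zeta> ^ k) ^ n)"
    by (simp only: Const_mult Const_power power_mult_distrib)
  hence *: "?b * ?y ^ n = var 2 ^ n"
    using assms by (simp add: power_mult_distrib mult.assoc [symmetric])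
  have "root_poly \<zeta> k * (- ?b * div_diff \<zeta> k (var 1 ^ n)) =
    - ?b * (root_poly \<zeta> k * div_diff \<zeta> k (var 1 ^ n))"
    by (simp only: mult_ac)
  also have "\<dots> = ?b * ?y ^ n - ?b * var 1 ^ n"
    by (simp add: div_diff_mult_root [OF assms] act_poly_power act_poly_refl_var right_diff_distrib)
  also have "\<dots> = var 2 ^ n - act_poly (refl_s \<zeta> k) (var 2 ^ n)"
    unfolding * by (simp only: act_poly_power act_poly_refl_var power_mult_distrib Const_power)
  finally show "root_poly \<zeta> k * (- Const (inverse (\<zeta> ^ k) ^ n) * div_diff \<zeta> k (var 1 ^ n)) =
    var 2 ^ n - act_poly (refl_s \<zeta> k) (var 2 ^ n)" .
qed

section \<open>The ideal generated by x1^p and x2^p and its stability properties\<close>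

definition frobenius_ideal :: "nat \<Rightarrow> 'k::field poly2 set" where
  "frobenius_ideal p = {f. \<exists>A B. f = var 1 ^ p * A + var 2 ^ p * B}"

lemma frobenius_ideal_var: "i \<in> {1, 2} \<Longrightarrow> var i ^ p \<in> frobenius_ideal p"
  unfolding frobenius_ideal_def
  by (auto intro: exI [of _ 1] exI [of _ 0])

lemma frobenius_ideal_add:
  assumes "f \<in> frobenius_ideal p" "g \<in> frobenius_ideal p"
  shows "f + g \<in> frobenius_ideal p"
proof -
  from assms obtain A B A' B' where "f = var 1 ^ p * A + var 2 ^ p * B"
    and "g = var 1 ^ p * A' + var 2 ^ p * B'"
    unfolding frobenius_ideal_def by blast
  hence "f + g = var 1 ^ p * (A + A') + var 2 ^ p * (B + B')"
    by (simp add: algebra_simps)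
  thus ?thesis unfolding frobenius_ideal_def by blast
qed

lemma frobenius_ideal_mult:
  assumes "f \<in> frobenius_ideal p"
  shows "g * f \<in> frobenius_ideal p"
proof -
  from assms obtain A B where "f = var 1 ^ p * A + var 2 ^ p * B"
    unfolding frobenius_ideal_def by blast
  hence "g * f = var 1 ^ p * (g * A) + var 2 ^ p * (g * B)"
    by (simp add: algebra_simps)
  thus ?thesis unfolding frobenius_ideal_def by blast
qed

lemma frobenius_ideal_mult2: "f \<in> frobenius_ideal p \<Longrightarrow> f * g \<in> frobenius_ideal p"
  by (subst mult.commute) (rule frobenius_ideal_mult)

lemma frobenius_ideal_0: "0 \<in> frobenius_ideal p"
  using frobenius_ideal_mult [OF frobenius_ideal_var [of 1], of 0] by simp

lemma frobenius_ideal_diff: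
  "f \<in> frobenius_ideal p \<Longrightarrow> g \<in> frobenius_ideal p \<Longrightarrow> f - g \<in> frobenius_ideal p"
  using frobenius_ideal_add [of f p "(-1) * g"] frobenius_ideal_mult [of g p "-1"] by simp

lemma frobenius_ideal_sum:
  "(\<And>x. x \<in> S \<Longrightarrow> f x \<in> frobenius_ideal p) \<Longrightarrow> sum f S \<in> frobenius_ideal p"
  by (induction S rule: infinite_finite_induct) (auto intro: frobenius_ideal_0 frobenius_ideal_add)

text \<open>Every monomial occurring in the ideal has an exponent of at least \<open>p\<close>. This
  yields homogeneity and, for constant terms, properness.\<close>

lemma coeff_frobenius_ideal:
  assumes "f \<in> frobenius_ideal p" "i < p" "j < p"
  shows "coeff (coeff f j) i = 0"
proof -
  from assms obtain A B where "f = var 1 ^ p * A + var 2 ^ p * B"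
    unfolding frobenius_ideal_def by blast
  thus ?thesis using assms by (simp add: var_power coeff_monom_mult)
qed

text \<open>The ideal is monomial: each term of \<open>f\<close> has coefficient zero or is
  divisible by one of the two generators.\<close>

lemma hom_component_frobenius_ideal:
  assumes "f \<in> frobenius_ideal p"
  shows "hom_component d f \<in> frobenius_ideal p"
  unfolding hom_component_def
proof (rule frobenius_ideal_sum)
  fix j
  let ?b = "coeff (coeff f j) (d - j)"
  show "monom (monom ?b (d - j)) j \<in> frobenius_ideal p"
  proof (cases "d - j < p \<and> j < p")
    case True
    thus ?thesis using coeff_frobenius_ideal [OF assms] by (simp add: frobenius_ideal_0)
  next
    case False
    have "var i ^ p dvd (var i ^ n :: 'a poly2)" if "p \<le> n" for i n
      using that by (rule le_imp_power_dvd)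
    hence "var 1 ^ p dvd monom (monom ?b (d - j)) j \<or> var 2 ^ p dvd monom (monom ?b (d - j)) j"
      unfolding monom_eq_var using False by (meson dvd_mult dvd_mult2 not_less)
    moreover have "g \<in> frobenius_ideal p" if "i \<in> {1, 2}" "var i ^ p dvd g" for i and g :: "'a poly2"
      using that by (metis dvdE frobenius_ideal_mult2 frobenius_ideal_var)
    ultimately show ?thesis by blast
  qed
qed

text \<open>In characteristic \<open>p\<close>, the p-th power of a linear form is a combination of
  x1^p and x2^p, so substituting linear forms keeps the generators in the ideal.\<close>

lemma act_poly_frobenius_ideal:
  fixes f :: "'k::field poly2"
  assumes "prime p" "CHAR('k) = p" "f \<in> frobenius_ideal p"
  shows "act_poly g f \<in> frobenius_ideal p"
proof -
  have "linear_poly u ^ p \<in> frobenius_ideal p" for u :: "'k \<times> 'k"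
  proof -
    have "linear_poly u ^ p = (Const (fst u) * var 1) ^ p + (Const (snd u) * var 2) ^ p"
      unfolding linear_poly_def by (rule freshmans_dream) (simp_all add: assms)
    thus ?thesis
      by (auto simp: power_mult_distrib intro!: frobenius_ideal_add frobenius_ideal_mult frobenius_ideal_var)
  qed
  moreover obtain A B where "f = var 1 ^ p * A + var 2 ^ p * B"
    using assms unfolding frobenius_ideal_def by blast
  ultimately show ?thesis
    by (simp only: act_poly_add act_poly_mult act_poly_power act_poly_var)
      (intro frobenius_ideal_add frobenius_ideal_mult2)
qed

lemma partial_deriv_add: "partial_deriv i (f + g) = partial_deriv i f + partial_deriv i g"
  by (auto simp: partial_deriv_def pderiv_add coeff_map_poly intro!: poly_eqI)

text \<open>The derivatives of x1^p and x2^p carry a factor p = 0, so both generators behave as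
  constants under differentiation.\<close>

lemma partial_deriv_frobenius_ideal:
  fixes f :: "'k::field poly2"
  assumes "CHAR('k) = p" "f \<in> frobenius_ideal p"
  shows "partial_deriv i f \<in> frobenius_ideal p"
proof -
  \<comment> \<open>Both rings matter: \<open>pderiv\<close> acts over \<open>'k\<close> in the
    inner variable and over \<open>'k poly\<close> in the outer one.\<close>
  have p0: "of_nat p = (0 :: 'k)" "of_nat p = (0 :: 'k poly)"
    using assms(1) by (auto simp: of_nat_eq_0_iff_char_dvd)
  obtain A B where f: "f = var 1 ^ p * A + var 2 ^ p * B"
    using assms unfolding frobenius_ideal_def by blast
  have "partial_deriv i (var 1 ^ p * A) = var 1 ^ p * partial_deriv i A"
    by (auto simp: partial_deriv_def var_power coeff_map_poly pderiv_mult pderiv_monom pderiv_smult p0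
        intro!: poly_eqI)
  moreover have "partial_deriv i (var 2 ^ p * B) = var 2 ^ p * partial_deriv i B"
    by (auto simp: partial_deriv_def var_power coeff_map_poly coeff_monom_mult pderiv_mult pderiv_monom p0
        intro!: poly_eqI)
  ultimately have "partial_deriv i f = var 1 ^ p * partial_deriv i A + var 2 ^ p * partial_deriv i B"
    by (simp add: f partial_deriv_add)
  thus ?thesis
    unfolding frobenius_ideal_def by blast
qed

text \<open>By the twisted Leibniz rule, a multiple \<open>var j ^ p * A\<close> contributes
  \<open>A\<close> times the vanishing sum, plus terms with the factor s(x_j^p), which lies in the
  ideal for every reflection s.\<close>

lemma div_diff_sum_frobenius_ideal:
  fixes f :: "'k::field poly2"
  assumes "prime p" "CHAR('k) = p" "\<zeta> \<noteq> 0"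
    and vanish: "\<And>j. j \<in> {1, 2} \<Longrightarrow> (\<Sum>k<m. Const (w k) * div_diff \<zeta> k (var j ^ p)) = 0"
    and "f \<in> frobenius_ideal p"
  shows "(\<Sum>k<m. Const (w k) * div_diff \<zeta> k f) \<in> frobenius_ideal p"
proof -
  have gen: "(\<Sum>k<m. Const (w k) * div_diff \<zeta> k (var j ^ p * A)) \<in> frobenius_ideal p"
    if j: "j \<in> {1, 2}" for j A
  proof -
    have "(\<Sum>k<m. Const (w k) * div_diff \<zeta> k (var j ^ p * A)) =
      (\<Sum>k<m. Const (w k) * div_diff \<zeta> k (var j ^ p)) * A +
      (\<Sum>k<m. Const (w k) * (act_poly (refl_s \<zeta> k) (var j ^ p) * div_diff \<zeta> k A))"
      by (simp add: div_diff_mult assms(3) ring_distribs sum.distrib sum_distrib_right mult.assoc)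
    also have "\<dots> \<in> frobenius_ideal p"
      unfolding vanish [OF j] mult_zero_left add_0
      by (rule frobenius_ideal_sum, rule frobenius_ideal_mult, rule frobenius_ideal_mult2)
        (rule act_poly_frobenius_ideal [OF assms(1,2) frobenius_ideal_var [OF j]])
    finally show ?thesis .
  qed
  obtain A B where f: "f = var 1 ^ p * A + var 2 ^ p * B"
    using assms unfolding frobenius_ideal_def by blast
  show ?thesis
    unfolding f div_diff_add [OF assms(3)] distrib_left sum.distrib
    by (intro frobenius_ideal_add gen) simp_all
qed

section \<open>Vanishing sums over the m-th roots of unity\<close>

lemma sum_primitive_root_power:
  assumes "primitive_root_of_unity m \<zeta>" "m > 0" "\<not> m dvd n"
  shows "(\<Sum>k<m. \<zeta> ^ (k * n)) = 0"
proof -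
  have \<zeta>: "\<zeta> ^ m = 1" "\<And>j. 0 < j \<Longrightarrow> j < m \<Longrightarrow> \<zeta> ^ j \<noteq> 1"
    using assms(1) by (auto simp: primitive_root_of_unity_def)
  have "\<zeta> ^ n = \<zeta> ^ (m * (n div m) + n mod m)"
    by simp
  also have "\<dots> = \<zeta> ^ (n mod m)"
    by (simp only: power_add power_mult \<zeta> power_one mult_1_left)
  \<comment> \<open>As \<open>m\<close> does not divide \<open>n\<close>, the remainder lies
    strictly between 0 and \<open>m\<close>, where primitivity applies.\<close>
  also have "\<dots> \<noteq> 1"
    using assms by (intro \<zeta>) (auto simp: dvd_eq_mod_eq_0)
  finally have "\<zeta> ^ n \<noteq> 1" .
  moreover have "(\<zeta> ^ n) ^ m = 1"
    using \<zeta> by (metis mult.commute power_mult power_one)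
  ultimately have "(\<Sum>k<m. (\<zeta> ^ n) ^ k) = 0"
    by (simp add: geometric_sum)
  moreover have "\<zeta> ^ (k * n) = (\<zeta> ^ n) ^ k" for k
    by (metis mult.commute power_mult)
  ultimately show ?thesis by simp
qed

text \<open>After interchanging the sums, the monomial with index \<open>r\<close> has as
  coefficient the sum of \<zeta>^(k(e+r)) over \<open>k < m\<close>, which vanishes separately for
  each \<open>r\<close>.\<close>

lemma sum_div_diff_var1_power:
  assumes "primitive_root_of_unity m \<zeta>" "m > 0" "\<And>r. r < p \<Longrightarrow> \<not> m dvd e + r"
  shows "(\<Sum>k<m. Const (\<zeta> ^ (k * e)) * div_diff \<zeta> k (var 1 ^ p)) = 0"
proof -
  have "(\<Sum>k<m. Const (\<zeta> ^ (k * e)) * div_diff \<zeta> k (var 1 ^ p)) =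
    (\<Sum>k<m. \<Sum>r<p. Const (\<zeta> ^ (k * (e + r))) * (var 1 ^ (p - Suc r) * var 2 ^ r))"
    unfolding div_diff_var1_power sum_distrib_left
    by (simp add: distrib_left power_add Const_mult mult.assoc)
  also have "\<dots> = (\<Sum>r<p. Const (\<Sum>k<m. \<zeta> ^ (k * (e + r))) * (var 1 ^ (p - Suc r) * var 2 ^ r))"
    by (subst sum.swap) (simp only: Const_sum sum_distrib_right)
  also have "\<dots> = 0"
    by (intro sum.neutral) (simp add: sum_primitive_root_power assms)
  finally show ?thesis .
qed

lemma primitive_root_nonzero: "primitive_root_of_unity m \<zeta> \<Longrightarrow> m > 0 \<Longrightarrow> \<zeta> \<noteq> 0"
  by (auto simp: primitive_root_of_unity_def power_0_left)

text \<open>Trades inverse powers for natural exponents, so that all weights take the form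
  \<open>\<zeta> ^ (k * e)\<close>.\<close>

lemma primitive_root_inverse_power:
  assumes "primitive_root_of_unity m \<zeta>" "n \<le> m"
  shows "inverse (\<zeta> ^ (n * k)) = \<zeta> ^ (k * (m - n))"
proof (rule inverse_unique)
  have "\<zeta> ^ (n * k) * \<zeta> ^ (k * (m - n)) = \<zeta> ^ (k * (n + (m - n)))"
    by (simp only: power_add [symmetric] distrib_left mult.commute [of n k])
  also have "\<dots> = (\<zeta> ^ m) ^ k"
    using assms(2) by (simp add: mult.commute flip: power_mult)
  finally show "\<zeta> ^ (n * k) * \<zeta> ^ (k * (m - n)) = 1"
    using assms(1) by (simp add: primitive_root_of_unity_def)
qed

text \<open>Passing from x2^p to x1^p costs the factor -\<zeta>^(-kp) = -\<zeta>^(k(m-p)), which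
  shifts \<open>e\<close> by \<open>m - p\<close>.\<close>

lemma sum_div_diff_var2_power:
  assumes "primitive_root_of_unity m \<zeta>" "m > 0" "p \<le> m" "\<And>r. r < p \<Longrightarrow> \<not> m dvd e + (m - p) + r"
  shows "(\<Sum>k<m. Const (\<zeta> ^ (k * e)) * div_diff \<zeta> k (var 2 ^ p)) = 0"
proof -
  have "inverse (\<zeta> ^ k) ^ p = \<zeta> ^ (k * (m - p))" for k
    using primitive_root_inverse_power [OF assms(1,3), of k]
    by (simp add: power_inverse mult.commute flip: power_mult)
  hence "(\<Sum>k<m. Const (\<zeta> ^ (k * e)) * div_diff \<zeta> k (var 2 ^ p)) =
    - (\<Sum>k<m. Const (\<zeta> ^ (k * (e + (m - p)))) * div_diff \<zeta> k (var 1 ^ p))"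
    using primitive_root_nonzero [OF assms(1,2)]
    by (simp add: div_diff_var2_power sum_negf distrib_left power_add Const_mult mult.assoc)
  also have "\<dots> = 0"
    using sum_div_diff_var1_power [OF assms(1,2,4)] by simp
  finally show ?thesis .
qed

text \<open>Here \<open>e\<close> is \<open>a\<close> or \<open>m - a\<close>, the latter because \<open>\<zeta>\<^bsup>-a\<^esup> = \<zeta>\<^bsup>m-a\<^esup>\<close>.\<close>

lemma sum_div_diff_var_power:
  assumes "primitive_root_of_unity m \<zeta>" "p < e" "p + e < m" "j \<in> {1, 2}" "i \<in> {1, 2}"
  shows "(\<Sum>k<m. Const (c * pairing i (alpha_root \<zeta> k) * \<zeta> ^ (k * e)) * div_diff \<zeta> k (var j ^ p)) = 0"
proof -
  \<comment> \<open>The pairing of the root with the second dual vector is -\<zeta>^k: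
    \<open>d\<close> records the shift of the exponent, \<open>b\<close> the sign.\<close>
  define d where "d = (if i = 1 then 0 else 1::nat)"
  define b where "b = (if i = 1 then c else - c)"
  have "d \<le> 1" by (simp add: d_def)
  have ndvd: "\<not> m dvd e + d + r" "\<not> m dvd e + d + (m - p) + r" if "r < p" for r
  proof -
    \<comment> \<open>Since \<open>d \<le> 1\<close> and \<open>r < p\<close>, the number is
      positive and at most \<open>e + p\<close>, hence below \<open>m\<close>.\<close>
    show "\<not> m dvd e + d + r"
      using assms that \<open>d \<le> 1\<close> by (intro nat_dvd_not_less) auto
    \<comment> \<open>This is the second exponent reduced by \<open>m\<close>; it is positive
      because \<open>p < e\<close>.\<close>
    have "\<not> m dvd e + d + r - p"
      using assms that \<open>d \<le> 1\<close> by (intro nat_dvd_not_less) auto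
    moreover have "e + d + (m - p) + r = e + d + r - p + m"
      using assms that by simp
    ultimately show "\<not> m dvd e + d + (m - p) + r" by simp
  qed
  have "c * pairing i (alpha_root \<zeta> k) * \<zeta> ^ (k * e) = b * \<zeta> ^ (k * (e + d))" for k
    using assms(5) by (auto simp: pairing_def alpha_root_def d_def b_def power_add distrib_left)
  hence "(\<Sum>k<m. Const (c * pairing i (alpha_root \<zeta> k) * \<zeta> ^ (k * e)) * div_diff \<zeta> k (var j ^ p)) =
    Const b * (\<Sum>k<m. Const (\<zeta> ^ (k * (e + d))) * div_diff \<zeta> k (var j ^ p))"
    by (simp add: Const_mult sum_distrib_left mult.assoc)
  also have "\<dots> = 0"
    using assms ndvd sum_div_diff_var1_power [OF assms(1), of p "e + d"]
      sum_div_diff_var2_power [OF assms(1), of p "e + d"] by auto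
  finally show ?thesis .
qed

section \<open>Coordinate formulas on the Verma module\<close>

lemma dunkl_eq:
  "dunkl m \<zeta> c a i F =
    (partial_deriv i (fst F) -
       (\<Sum>k<m. Const (c * pairing i (alpha_root \<zeta> k) * inverse (\<zeta> ^ (a * k))) * div_diff \<zeta> k (snd F)),
     partial_deriv i (snd F) -
       (\<Sum>k<m. Const (c * pairing i (alpha_root \<zeta> k) * \<zeta> ^ (a * k)) * div_diff \<zeta> k (fst F)))"
  \<comment> \<open>Reflections exchange the two lines spanned by the basis of the representation,
    so the reflection sum in each component involves the other component of
    \<open>F\<close>.\<close>
  by (simp add: dunkl_def tensor_extend_def tensor_def basis_e_def rho_s_def antidiag_def
      fst_sum snd_sum prod_eq_iff div_diff_def root_poly_def Const_mult mult_ac)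

lemma dunkl_add:
  assumes "\<zeta> \<noteq> 0"
  shows "dunkl m \<zeta> c a i (F + G) = dunkl m \<zeta> c a i F + dunkl m \<zeta> c a i G"
  by (simp add: dunkl_eq partial_deriv_add div_diff_add [OF assms] distrib_left sum.distrib)

lemma scale_add: "scale g (F + G) = scale g F + scale g G"
  and scale_add_left: "scale (g + h) F = scale g F + scale h F"
  and scale_mult: "scale (g * h) F = scale g (scale h F)"
  by (simp_all add: scale_def algebra_simps)

lemma diag_action_eq:
  "diag_action g r F =
    (Const (fst (r (1, 0))) * act_poly g (fst F) + Const (fst (r (0, 1))) * act_poly g (snd F),
     Const (snd (r (1, 0))) * act_poly g (fst F) + Const (snd (r (0, 1))) * act_poly g (snd F))"
  by (simp add: diag_action_def tensor_extend_def tensor_def basis_e_def)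

lemma diag_action_add: "diag_action g r (F + G) = diag_action g r F + diag_action g r G"
  by (simp add: diag_action_eq act_poly_add algebra_simps)

lemma hom_component_add: "hom_component d (f + g) = hom_component d f + hom_component d g"
  by (simp add: hom_component_def sum.distrib flip: add_monom)

text \<open>Closure under \<open>scale g\<close> for all polynomials covers scalars and variables at
  once, and the vector \<open>(1, 1)\<close> is easily excluded by looking at constant
  terms.\<close>

lemma proper_graded_submoduleI:
  assumes "0 \<in> N" and "\<And>F G. F \<in> N \<Longrightarrow> G \<in> N \<Longrightarrow> F + G \<in> N"
    and "\<And>g F. F \<in> N \<Longrightarrow> scale g F \<in> N"
    and "\<And>g r F. F \<in> N \<Longrightarrow> (g, r) \<in> dihedral_rep m \<zeta> a \<Longrightarrow> diag_action g r F \<in> N"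
    and "\<And>i F. F \<in> N \<Longrightarrow> i \<in> {1, 2} \<Longrightarrow> dunkl m \<zeta> c a i F \<in> N"
    and "\<And>d F. F \<in> N \<Longrightarrow> (hom_component d (fst F), hom_component d (snd F)) \<in> N"
    and "(1, 1) \<notin> N"
  shows "proper_graded_submodule m \<zeta> c a N"
proof -
  have subspace: "is_subspace N"
    unfolding is_subspace_def by (intro conjI ballI allI; rule assms(1-3); assumption)
  have submodule: "is_submodule m \<zeta> c a N"
    unfolding is_submodule_def
  proof (intro conjI ballI subspace case_prodI2)
    show "diag_action g r F \<in> N" if "x \<in> dihedral_rep m \<zeta> a" "x = (g, r)" "F \<in> N" for x g r F
      by (rule assms(4) [OF that(3)]) (use that(1,2) in simp)
  qed (rule assms(3,5); assumption)+
  have graded: "is_graded N"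
    unfolding is_graded_def by (intro ballI allI assms(6))
  have "N \<noteq> UNIV" using assms(7) by auto
  with submodule graded show ?thesis
    unfolding proper_graded_submodule_def by (intro conjI)
qed

section \<open>The proper graded submodule given by the Frobenius ideal\<close>

lemma proper_graded_submodule_frobenius:
  fixes \<zeta> c :: "'k::field"
  assumes "prime p" "CHAR('k) = p" "primitive_root_of_unity m \<zeta>" "p < a" "2 * a < m"
  shows "proper_graded_submodule m \<zeta> c a (frobenius_ideal p \<times> frobenius_ideal p)"
proof -
  have \<zeta>: "\<zeta> \<noteq> 0" using primitive_root_nonzero [OF assms(3)] assms(5) by simp
  let ?I = "frobenius_ideal p :: 'k poly2 set"
  have D: "(\<Sum>k<m. Const (c * pairing i (alpha_root \<zeta> k) * \<zeta> ^ (k * e)) * div_diff \<zeta> k f) \<in> ?I"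
    if "f \<in> ?I" "i \<in> {1, 2}" "p < e" "p + e < m" for f i e
    by (rule div_diff_sum_frobenius_ideal [OF assms(1,2) \<zeta> _ that(1)])
      (rule sum_div_diff_var_power [OF assms(3) that(3,4) _ that(2)])
  have inv: "inverse (\<zeta> ^ (a * k)) = \<zeta> ^ (k * (m - a))" for k
    using assms by (intro primitive_root_inverse_power) auto
  have dunkl: "dunkl m \<zeta> c a i F \<in> ?I \<times> ?I" if F: "F \<in> ?I \<times> ?I" and i: "i \<in> {1, 2}" for F i
  proof -
    from F have F: "fst F \<in> ?I" "snd F \<in> ?I" by auto
    \<comment> \<open>The weights in the two components have exponents \<open>a\<close> and
      \<open>m - a\<close>; both are more than \<open>p\<close> away from 0 and from
      \<open>m\<close>.\<close>
    have a: "p < a" "p + a < m" "p < m - a" "p + (m - a) < m" using assms by auto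
    show ?thesis
      \<comment> \<open>\<open>inv\<close> must rewrite the inverse powers before the remaining
        \<open>a * k\<close> is commuted into the form expected by \<open>D\<close>.\<close>
      unfolding dunkl_eq inv unfolding mult.commute [of a]
      by (rule SigmaI; rule frobenius_ideal_diff)
        (rule partial_deriv_frobenius_ideal [OF assms(2)] D F i a)+
  qed
  have diag: "diag_action g r F \<in> ?I \<times> ?I" if F: "F \<in> ?I \<times> ?I" for g r F
  proof -
    from F have "act_poly g (fst F) \<in> ?I" "act_poly g (snd F) \<in> ?I"
      using act_poly_frobenius_ideal [OF assms(1,2)] by auto
    thus ?thesis
      unfolding diag_action_eq by (simp add: frobenius_ideal_add frobenius_ideal_mult)
  qed
  have hom: "(hom_component d (fst F), hom_component d (snd F)) \<in> ?I \<times> ?I" if "F \<in> ?I \<times> ?I" for d F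
    using that hom_component_frobenius_ideal by auto
  have scale: "scale g F \<in> ?I \<times> ?I" if "F \<in> ?I \<times> ?I" for g F
    using that frobenius_ideal_mult by (auto simp: scale_def)
  have add: "F + G \<in> ?I \<times> ?I" if "F \<in> ?I \<times> ?I" "G \<in> ?I \<times> ?I" for F G
    using that frobenius_ideal_add by auto
  have zero: "0 \<in> ?I \<times> ?I"
    using frobenius_ideal_0 by (simp add: zero_prod_def)
  have one: "(1, 1) \<notin> ?I \<times> ?I"
    using coeff_frobenius_ideal [of "1 :: 'k poly2" p 0 0] prime_gt_0_nat [OF assms(1)] by auto
  show ?thesis
    by (rule proper_graded_submoduleI [OF zero add scale diag dunkl hom one])
qed

section \<open>The degree zero part of a submodule\<close>

lemma submodule_scale:
  assumes "is_submodule m \<zeta> c a N" "F \<in> N"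
  shows "scale g F \<in> N"
proof -
  have N: "0 \<in> N" "\<And>F G. F \<in> N \<Longrightarrow> G \<in> N \<Longrightarrow> F + G \<in> N"
    "\<And>b F. F \<in> N \<Longrightarrow> scale (Const b) F \<in> N" "\<And>F. F \<in> N \<Longrightarrow> scale (var 1) F \<in> N"
    "\<And>F. F \<in> N \<Longrightarrow> scale (var 2) F \<in> N"
    using assms(1) by (auto simp: is_submodule_def is_subspace_def)
  have zero: "scale 0 F = 0" by (simp add: scale_def zero_prod_def)
  \<comment> \<open>Nested Horner induction: polynomials in x1 are built from constants, then serve
    as coefficients of powers of x2.\<close>
  have inner: "scale [:q:] F \<in> N" for q
  proof (induction q)
    case (pCons b q)
    have "[:pCons b q:] = Const b + var 1 * [:q:]" by (simp add: Const_def var_def)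
    thus ?case by (simp only: scale_add_left scale_mult) (intro N pCons assms)
  qed (simp add: zero N)
  show ?thesis
  proof (induction g)
    case (pCons q g)
    have "pCons q g = [:q:] + var 2 * g" by (simp add: var_def)
    thus ?case by (simp only: scale_add_left scale_mult) (intro N pCons inner)
  qed (simp add: zero N)
qed

lemma submodule_eq_UNIV:
  assumes "is_submodule m \<zeta> c a N" "(1, 0) \<in> N" "(0, 1) \<in> N"
  shows "N = UNIV"
proof -
  have "(f, g) \<in> N" for f g
  proof -
    have "scale f (1, 0) + scale g (0, 1) \<in> N"
      using assms submodule_scale [OF assms(1)]
      by (auto simp: is_submodule_def is_subspace_def)
    thus ?thesis by (simp add: scale_def)
  qed
  thus ?thesis by auto
qed

text \<open>The degree zero part of \<open>N\<close> is a subrepresentation of an irreducible one.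
  If nonzero, it contains both basis vectors, which generate the whole module.\<close>

lemma proper_graded_submodule_constant_coeff:
  assumes "primitive_root_of_unity m \<zeta>" "0 < a" "2 * a < m"
    and "proper_graded_submodule m \<zeta> c a N" "F \<in> N"
  shows "coeff (coeff (fst F) 0) 0 = 0 \<and> coeff (coeff (snd F) 0) 0 = 0"
proof -
  have \<zeta>: "\<zeta> \<noteq> 0" using primitive_root_nonzero [OF assms(1)] assms(3) by simp
  have sub: "is_submodule m \<zeta> c a N" and "N \<noteq> UNIV"
    using assms by (auto simp: proper_graded_submodule_def)
  have lin: "(Const x, Const y) + (Const x', Const y') \<in> N" "(Const (b * x), Const (b * y)) \<in> N"
    if "(Const x, Const y) \<in> N" "(Const x', Const y') \<in> N" for x y x' y' b
  proof -
    have "scale (Const b) (Const x, Const y) \<in> N"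
      by (rule submodule_scale [OF sub that(1)])
    thus "(Const (b * x), Const (b * y)) \<in> N"
      by (simp add: scale_def Const_mult)
    show "(Const x, Const y) + (Const x', Const y') \<in> N"
      using that sub unfolding is_submodule_def is_subspace_def by blast
  qed
  have s: "(Const (inverse (\<zeta> ^ (a * k)) * y), Const (\<zeta> ^ (a * k) * x)) \<in> N"
    if "(Const x, Const y) \<in> N" "k < m" for x y k
  proof -
    have "(refl_s \<zeta> k, rho_s \<zeta> a k) \<in> dihedral_rep m \<zeta> a"
      using that by (intro dihedral_rep.refl)
    hence "diag_action (refl_s \<zeta> k) (rho_s \<zeta> a k) (Const x, Const y) \<in> N"
      using sub that unfolding is_submodule_def by blast
    thus ?thesis by (simp add: diag_action_eq rho_s_def antidiag_def Const_mult)
  qed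
  \<comment> \<open>The reflection with index 0 exchanges the basis vectors.\<close>
  have swap: "(Const y, Const x) \<in> N" if "(Const x, Const y) \<in> N" for x y
    using s [OF that, of 0] assms by simp
  have zero: "x = 0" if xy: "(Const x, Const y) \<in> N" for x y
  proof (rule ccontr)
    assume "x \<noteq> 0"
    let ?z = "\<zeta> ^ a"
    define b where "b = inverse ?z - ?z"
    \<comment> \<open>Composing the reflections with indices 0 and 1 gives a diagonal map.
      Subtracting \<open>?z\<close> times the original vector then kills the second
      coordinate.\<close>
    have "(Const (inverse ?z * x), Const (?z * y)) \<in> N"
      using s [OF swap [OF xy], of 1] assms by simp
    from lin(1) [OF this lin(2) [OF xy xy, of "- ?z"]]
    have *: "(Const (b * x), Const 0) \<in> N"
      by (simp add: b_def left_diff_distrib Const_diff Const_minus)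
    \<comment> \<open>This is \<zeta>^(2a) with 0 < 2a < m: the two eigenvalues
      \<open>inverse ?z\<close> and \<open>?z\<close> differ, which is the source of
      irreducibility.\<close>
    have "?z * ?z \<noteq> 1"
      using assms by (auto simp: primitive_root_of_unity_def simp flip: power_add mult_2)
    hence "b \<noteq> 0"
      using \<zeta> by (simp add: b_def field_simps)
    hence b: "inverse (b * x) * (b * x) = 1"
      using \<open>x \<noteq> 0\<close> by (intro left_inverse) simp
    have "(Const 1, Const 0) \<in> N"
      using lin(2) [OF * *, of "inverse (b * x)"] unfolding b by simp
    from submodule_eq_UNIV [OF sub] this swap [OF this] \<open>N \<noteq> UNIV\<close> show False by simp
  qed
  \<comment> \<open>Gradedness places the vector of constant terms of \<open>F\<close> in
    \<open>N\<close>.\<close>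
  have "hom_component 0 f = Const (coeff (coeff f 0) 0)" for f :: "'a poly2"
    by (simp add: hom_component_def Const_def monom_0)
  hence "(Const (coeff (coeff (fst F) 0) 0), Const (coeff (coeff (snd F) 0) 0)) \<in> N"
    using assms unfolding proper_graded_submodule_def is_graded_def by metis
  thus ?thesis using zero swap by blast
qed

section \<open>Sums of proper graded submodules and the maximal one\<close>

lemma proper_graded_submodule_sum:
  assumes "primitive_root_of_unity m \<zeta>" "0 < a" "2 * a < m"
    and M: "proper_graded_submodule m \<zeta> c a M" and N: "proper_graded_submodule m \<zeta> c a N"
  shows "proper_graded_submodule m \<zeta> c a {F + G |F G. F \<in> M \<and> G \<in> N}"
    (is "proper_graded_submodule _ _ _ _ ?S")
proof -
  have \<zeta>: "\<zeta> \<noteq> 0" using primitive_root_nonzero [OF assms(1)] assms(3) by simp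
  have subM: "is_submodule m \<zeta> c a M" "is_graded M" and subN: "is_submodule m \<zeta> c a N" "is_graded N"
    using M N by (auto simp: proper_graded_submodule_def)
  \<comment> \<open>Any additive operator preserving both summands preserves the sum; every closure
    property except addition is an instance.\<close>
  have lift: "T F \<in> ?S" if "F \<in> ?S" "\<And>F G. T (F + G) = T F + T G" "\<And>F. F \<in> M \<Longrightarrow> T F \<in> M"
    "\<And>F. F \<in> N \<Longrightarrow> T F \<in> N" for T F
  proof -
    from that(1) obtain G H where GH: "F = G + H" "G \<in> M" "H \<in> N" by blast
    have "T F = T G + T H" unfolding GH(1) by (rule that(2))
    thus ?thesis using that(3) [OF GH(2)] that(4) [OF GH(3)] by blast
  qed
  have add: "F + G \<in> ?S" if "F \<in> ?S" "G \<in> ?S" for F G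
  proof -
    from that(1) obtain F1 F2 where F: "F = F1 + F2" "F1 \<in> M" "F2 \<in> N" by blast
    from that(2) obtain G1 G2 where G: "G = G1 + G2" "G1 \<in> M" "G2 \<in> N" by blast
    have "F + G = (F1 + G1) + (F2 + G2)" by (simp only: F(1) G(1) add_ac)
    moreover have "F1 + G1 \<in> M" "F2 + G2 \<in> N"
      using F G subM subN unfolding is_submodule_def is_subspace_def by blast+
    ultimately show ?thesis by blast
  qed
  have zero: "0 \<in> ?S"
  proof -
    have "0 \<in> M" "0 \<in> N"
      using subM subN unfolding is_submodule_def is_subspace_def by blast+
    hence "0 + 0 \<in> ?S" by blast
    thus ?thesis by simp
  qed
  have scale: "scale g F \<in> ?S" if "F \<in> ?S" for g F
    by (rule lift [OF that scale_add])
      (rule submodule_scale [OF subM(1)] submodule_scale [OF subN(1)], assumption)+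
  have diag: "diag_action g r F \<in> ?S" if "F \<in> ?S" "(g, r) \<in> dihedral_rep m \<zeta> a" for g r F
    by (rule lift [OF that(1) diag_action_add]) (use that(2) subM subN in \<open>unfold is_submodule_def, blast\<close>)+
  have dunkl: "dunkl m \<zeta> c a i F \<in> ?S" if "F \<in> ?S" "i \<in> {1, 2}" for i F
    by (rule lift [OF that(1) dunkl_add [OF \<zeta>]]) (use that(2) subM subN in \<open>unfold is_submodule_def, blast\<close>)+
  have hom: "(hom_component d (fst F), hom_component d (snd F)) \<in> ?S" if "F \<in> ?S" for F d
    by (rule lift [where T = "\<lambda>F. (hom_component d (fst F), hom_component d (snd F))", OF that])
      (use subM subN in \<open>auto simp: is_graded_def hom_component_add\<close>)
  \<comment> \<open>Constant terms vanish on \<open>M\<close> and on \<open>N\<close>, hence on the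
    sum, so properness survives.\<close>
  have one: "(1, 1) \<notin> ?S"
  proof
    assume "(1, 1) \<in> ?S"
    then obtain F G where FG: "(1, 1) = F + G" "F \<in> M" "G \<in> N" by blast
    from FG(1) have "coeff (coeff 1 0) 0 = coeff (coeff (fst F) 0) 0 + coeff (coeff (fst G) 0) 0"
      by (metis coeff_add fst_add fst_conv)
    thus False
      using proper_graded_submodule_constant_coeff [OF assms(1-3) M FG(2)]
        proper_graded_submodule_constant_coeff [OF assms(1-3) N FG(3)] by simp
  qed
  show ?thesis
    by (rule proper_graded_submoduleI [OF zero add scale diag dunkl hom one])
qed

text \<open>The family of proper graded submodules is closed under pairwise sums, so its union is
  again a member, the greatest one. \<open>N0\<close> makes the family nonempty, which puts 0 in the
  union.\<close>

lemma Jc_eq_Union: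
  assumes "primitive_root_of_unity m \<zeta>" "0 < a" "2 * a < m"
    and "proper_graded_submodule m \<zeta> c a N0"
  shows "Jc m \<zeta> c a = \<Union> {N. proper_graded_submodule m \<zeta> c a N}" (is "_ = ?J")
proof -
  let ?P = "proper_graded_submodule m \<zeta> c a"
  have add: "F + G \<in> ?J" if FG: "F \<in> ?J" "G \<in> ?J" for F G
  proof -
    from FG obtain M N where MN: "?P M" "?P N" "F \<in> M" "G \<in> N" by blast
    have "F + G \<in> {F + G |F G. F \<in> M \<and> G \<in> N}" using MN by blast
    thus ?thesis using proper_graded_submodule_sum [OF assms(1-3) MN(1,2)] by blast
  qed
  have zero: "0 \<in> ?J"
    using assms(4) by (auto simp: proper_graded_submodule_def is_submodule_def is_subspace_def)
  have scale: "scale g F \<in> ?J" if "F \<in> ?J" for g F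
    using that submodule_scale unfolding proper_graded_submodule_def by blast
  have diag: "diag_action g r F \<in> ?J" if "F \<in> ?J" "(g, r) \<in> dihedral_rep m \<zeta> a" for g r F
    using that unfolding proper_graded_submodule_def is_submodule_def by blast
  have dunkl: "dunkl m \<zeta> c a i F \<in> ?J" if "F \<in> ?J" "i \<in> {1, 2}" for i F
    using that unfolding proper_graded_submodule_def is_submodule_def by blast
  have hom: "(hom_component d (fst F), hom_component d (snd F)) \<in> ?J" if "F \<in> ?J" for F d
    using that unfolding proper_graded_submodule_def is_graded_def by blast
  have one: "(1, 1) \<notin> ?J"
  proof
    assume "(1, 1) \<in> ?J"
    then obtain N where "?P N" "(1, 1) \<in> N" by blast
    from proper_graded_submodule_constant_coeff [OF assms(1-3) this] show False by simp
  qed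
  have J: "?P ?J"
    by (rule proper_graded_submoduleI [OF zero add scale diag dunkl hom one])
  show ?thesis
    unfolding Jc_def
  proof (rule the_equality)
    \<comment> \<open>A greatest member is maximal, and every maximal member must equal it; this
      settles existence and uniqueness for \<open>THE\<close>.\<close>
    have max: "N \<subseteq> ?J" if "?P N" for N
      using that by blast
    show "?P ?J \<and> (\<forall>N'. ?P N' \<and> ?J \<subseteq> N' \<longrightarrow> N' = ?J)"
      by (intro conjI J allI impI subset_antisym max) (elim conjE, assumption)+
    show "N = ?J" if "?P N \<and> (\<forall>N'. ?P N' \<and> N \<subseteq> N' \<longrightarrow> N' = N)" for N
    proof -
      from that have N: "?P N" and eq: "?P ?J \<and> N \<subseteq> ?J \<longrightarrow> ?J = N" by blast+
      show ?thesis by (rule eq [rule_format, OF conjI [OF J max [OF N]], symmetric])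
    qed
  qed
qed

theorem theorem4p2:
  fixes p m a :: nat and \<zeta> c :: "'k::field"
  assumes "prime p" and "odd m" and "m > 0" and "\<not> p dvd m"
    and "CHAR('k) = p"
    and "primitive_root_of_unity m \<zeta>"
    and "p < a" and "2 * a < m"
  shows "tensor (var 1 ^ p) (basis_e 1) \<in> Jc m \<zeta> c a \<and>
         tensor (var 1 ^ p) (basis_e 2) \<in> Jc m \<zeta> c a \<and>
         tensor (var 2 ^ p) (basis_e 1) \<in> Jc m \<zeta> c a \<and>
         tensor (var 2 ^ p) (basis_e 2) \<in> Jc m \<zeta> c a"
proof -
  \<comment> \<open>Used twice: as the nonemptiness witness for the union, and as the member
    containing all four vectors.\<close>
  have N: "proper_graded_submodule m \<zeta> c a (frobenius_ideal p \<times> frobenius_ideal p)"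
    using assms by (intro proper_graded_submodule_frobenius)
  have "Jc m \<zeta> c a = \<Union> {N. proper_graded_submodule m \<zeta> c a N}"
    using assms N by (intro Jc_eq_Union) auto
  hence "frobenius_ideal p \<times> frobenius_ideal p \<subseteq> Jc m \<zeta> c a"
    using N by blast
  moreover have "tensor (var i ^ p) v \<in> frobenius_ideal p \<times> frobenius_ideal p"
    if "i \<in> {1, 2}" for i and v :: "'k \<times> 'k"
    using that by (auto simp: tensor_def intro!: frobenius_ideal_mult frobenius_ideal_var)
  ultimately show ?thesis by blast
qed

end
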